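(* Let $E$ be an entire function in the Hermite-Biehler class $\mathcal{H}B$ such that the de Branges space $H(E)$ is regular, and let $\phi$ be a non-constant entire function. If the composition operator $C_\phi$, $C_\phi f=f\circ\phi$, is bounded on $H(E)$, then $\phi$ is affine, i.e. there are $a,b\in\mathbb{C}$ with $\phi(z)=az+b$ for all $z\in\mathbb{C}$.
   Context: $\mathbb{C}_+$ is the open upper half-plane; for an entire function $f$, $f^{\#}(z):=\overline{f(\bar z)}$. $H^2(\mathbb{C}_+)$ is the Hardy Hilbert space on $\mathbb{C}_+$. An entire function $E$ is in the Hermite-Biehler class $\mathcal{H}B$ if $|E(\bar z)|<|E(z)|$ for all $z\in\mathbb{C}_+$. For $E\in\mathcal{H}B$ the de Branges space is $$H(E):=\left\{f \text{ entire}: \tfrac{f}{E},\ \tfrac{f^{\#}}{E}\in H^2(\mathbb{C}_+)\right\},\qquad \langle f,g\rangle_{H(E)}=\int_{-\infty}^{\infty}\frac{f(t)\overline{g(t)}}{|E(t)|^2}\,dt .$$ For $\alpha\in\mathbb{C}$ the generalized backward shift $R_\alpha$ is defined on entire functions by $(R_\alpha g)(\xi)=\frac{g(\xi)-g(\alpha)}{\xi-\alpha}$ for $\xi\neq\alpha$ and $(R_\alpha g)(\alpha)=g'(\alpha)$. The space $H(E)$ is called regular if $R_\alpha H(E)\subseteq H(E)$ for every $\alpha\in\mathbb{C}$. Saying that $C_\phi$ is bounded on $H(E)$ means that $f\circ\phi\in H(E)$ for every $f\in H(E)$ and $f\mapsto f\circ\phi$ is a bounded linear operator on $H(E)$.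
   Formalization: Adds the hypothesis that H(E) contains a non-constant function; without it the claim fails, e.g. for E(z)=z+i, where H(E) is the constants, is regular, and every composition operator is the identity. *)

theory Defs
  imports "HOL-Complex_Analysis.Complex_Analysis"
begin

abbreviation upper_half_plane :: "complex set"
  where "upper_half_plane \<equiv> {z. 0 < Im z}"

definition sharp :: "(complex \<Rightarrow> complex) \<Rightarrow> complex \<Rightarrow> complex"
  where "sharp f z = cnj (f (cnj z))"

definition hardy_H2 :: "(complex \<Rightarrow> complex) set"
  where "hardy_H2 =
    {f. f holomorphic_on upper_half_plane \<and>
        (SUP y\<in>{0<..}. \<integral>\<^sup>+ x. ennreal ((cmod (f (Complex x y)))\<^sup>2) \<partial>lborel) < \<infinity>}"

definition hermite_biehler :: "(complex \<Rightarrow> complex) \<Rightarrow> bool"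
  where "hermite_biehler E \<longleftrightarrow>
    E holomorphic_on UNIV \<and> (\<forall>z\<in>upper_half_plane. cmod (E (cnj z)) < cmod (E z))"

definition de_Branges :: "(complex \<Rightarrow> complex) \<Rightarrow> (complex \<Rightarrow> complex) set"
  where "de_Branges E =
    {f. f holomorphic_on UNIV \<and>
        (\<lambda>z. f z / E z) \<in> hardy_H2 \<and> (\<lambda>z. sharp f z / E z) \<in> hardy_H2}"

text \<open>\<open>E\<close> may vanish at points of the real line; these form a null set, so the value of the
  quotient there is irrelevant.\<close>

definition dB_inner ::
    "(complex \<Rightarrow> complex) \<Rightarrow> (complex \<Rightarrow> complex) \<Rightarrow> (complex \<Rightarrow> complex) \<Rightarrow> complex"
  where "dB_inner E f g =
    (LINT t|lborel. f (complex_of_real t) * cnj (g (complex_of_real t)) /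
                    complex_of_real ((cmod (E (complex_of_real t)))\<^sup>2))"

definition dB_norm :: "(complex \<Rightarrow> complex) \<Rightarrow> (complex \<Rightarrow> complex) \<Rightarrow> real"
  where "dB_norm E f = sqrt (Re (dB_inner E f f))"

definition gen_backward_shift ::
    "complex \<Rightarrow> (complex \<Rightarrow> complex) \<Rightarrow> complex \<Rightarrow> complex"
  where "gen_backward_shift \<alpha> g \<xi> =
    (if \<xi> = \<alpha> then deriv g \<alpha> else (g \<xi> - g \<alpha>) / (\<xi> - \<alpha>))"

definition dB_regular :: "(complex \<Rightarrow> complex) \<Rightarrow> bool"
  where "dB_regular E \<longleftrightarrow>
    (\<forall>\<alpha>. gen_backward_shift \<alpha> ` de_Branges E \<subseteq> de_Branges E)"

definition dB_bounded_operator ::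
    "(complex \<Rightarrow> complex) \<Rightarrow> ((complex \<Rightarrow> complex) \<Rightarrow> (complex \<Rightarrow> complex)) \<Rightarrow> bool"
  where "dB_bounded_operator E T \<longleftrightarrow>
    (\<forall>f\<in>de_Branges E. T f \<in> de_Branges E) \<and>
    (\<forall>f\<in>de_Branges E. \<forall>g\<in>de_Branges E. T (\<lambda>z. f z + g z) = (\<lambda>z. T f z + T g z)) \<and>
    (\<forall>c. \<forall>f\<in>de_Branges E. T (\<lambda>z. c * f z) = (\<lambda>z. c * T f z)) \<and>
    (\<exists>K. \<forall>f\<in>de_Branges E. dB_norm E (T f) \<le> K * dB_norm E f)"

definition composition_operator ::
    "(complex \<Rightarrow> complex) \<Rightarrow> (complex \<Rightarrow> complex) \<Rightarrow> (complex \<Rightarrow> complex)"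
  where "composition_operator \<phi> f = f \<circ> \<phi>"

text \<open>The constants form a regular de Branges space, \<open>E z = z + \<i>\<close>, on which every composition
  operator is the identity. This predicate excludes exactly that space.\<close>

definition dB_nondegenerate :: "(complex \<Rightarrow> complex) \<Rightarrow> bool"
  where "dB_nondegenerate E \<longleftrightarrow> (\<exists>f\<in>de_Branges E. \<not> f constant_on UNIV)"

end

theory Submission
  imports Defs
begin

text \<open>
  Suppose that \<open>\<phi>\<close> is not affine, and take a nonconstant \<open>f\<close> in the space. The iterates
  \<open>f \<circ> \<phi> ^^ n\<close> stay in the space, and their norms grow at most like \<open>K ^ n\<close>, where \<open>K\<close> bounds the
  composition operator. Evaluation is locally bounded on a de Branges space
  (\<open>de_Branges_evaluation_locally_bounded\<close>), so \<open>f \<circ> \<phi> ^^ n\<close> is \<open>O(K ^ n)\<close> on any fixed disc.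

  On the other hand \<open>\<phi>\<close> is strongly expanding: by Schottky's theorem, the image of a large disc of
  radius \<open>r\<close> contains a full circle of radius at least \<open>2 * K * r\<close>
  (\<open>image_contains_circle\<close>). By the maximum principle, every bound for \<open>g \<circ> \<phi>\<close> on the first disc
  is a bound for \<open>g\<close> on the disc of radius \<open>2 * K * r\<close> (\<open>nonaffine_entire_pulls_back_bounds\<close>).
  Iterating, \<open>f\<close> is \<open>O(K ^ n)\<close> on discs whose radii grow like \<open>(2 * K) ^ n\<close>. This growth is
  slower than linear, and \<open>f\<close> is constant after all.

  The analytic part is the bound for evaluations by the norm, which is an integral over the real
  line only. It compares the horizontal integrals of \<open>f / E\<close> of a fixed length in the upper half-plane
  with those on the real line by a Phragmen-Lindelof argument
  (\<open>half_plane_bound_by_boundary_L2\<close>), and recovers the values of the function from them.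
\<close>

section \<open>Half-plane functions controlled by horizontal averages\<close>

text \<open>The Cauchy-Schwarz inequality against the constant \<open>1\<close>: the variance of \<open>cmod (g s)\<close> over
  \<open>{0..h}\<close> is nonnegative.\<close>
lemma norm_integral_le_L2:
  fixes g :: "real \<Rightarrow> complex"
  assumes cont: "continuous_on {0..h} g" and h: "0 < h" and N: "0 \<le> N"
    and L2: "(\<integral>\<^sup>+ s. ennreal ((cmod (g s))\<^sup>2) * indicator {0..h} s \<partial>lborel) \<le> ennreal (N\<^sup>2)"
  shows "cmod (integral {0..h} g) \<le> N * sqrt h"
proof -
  define q where "q = integral {0..h} (\<lambda>s. (cmod (g s))\<^sup>2)"
  define j where "j = integral {0..h} (\<lambda>s. cmod (g s))"
  have Q: "((\<lambda>s. (cmod (g s))\<^sup>2) has_integral q) {0..h}"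
    unfolding q_def by (intro integrable_integral integrable_continuous_real continuous_intros cont)
  have J: "((\<lambda>s. cmod (g s)) has_integral j) {0..h}"
    unfolding j_def by (intro integrable_integral integrable_continuous_real continuous_intros cont)
  have "ennreal q \<le> ennreal (N\<^sup>2)"
    using nn_integral_has_integral_lebesgue'[OF _ Q] L2 by simp
  then have qN: "q \<le> N\<^sup>2"
    by simp
  have "((\<lambda>s. (cmod (g s))\<^sup>2 - 2 * (j / h) * cmod (g s) + (j / h)\<^sup>2) has_integral
      (q - 2 * (j / h) * j + h * (j / h)\<^sup>2)) {0..h}"
    using has_integral_add[OF has_integral_diff[OF Q has_integral_mult_right[OF J, of "2 * (j / h)"]]
        has_integral_const_real[of "(j / h)\<^sup>2" 0 h]] h by simp
  then have "0 \<le> q - 2 * (j / h) * j + h * (j / h)\<^sup>2"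
  proof (rule has_integral_nonneg)
    fix s
    have "(cmod (g s))\<^sup>2 - 2 * (j / h) * cmod (g s) + (j / h)\<^sup>2 = (cmod (g s) - j / h)\<^sup>2"
      by (simp add: power2_eq_square algebra_simps)
    then show "0 \<le> (cmod (g s))\<^sup>2 - 2 * (j / h) * cmod (g s) + (j / h)\<^sup>2" by simp
  qed
  then have "j\<^sup>2 \<le> h * q"
    using h by (simp add: field_simps power2_eq_square)
  also have "\<dots> \<le> h * N\<^sup>2" using qN h by simp
  also have "\<dots> = (N * sqrt h)\<^sup>2" using h by (simp add: power_mult_distrib)
  finally have "j \<le> N * sqrt h"
    by (rule power2_le_imp_le) (use N h in simp)
  moreover have "cmod (integral {0..h} g) \<le> j"
    unfolding j_def
    by (rule integral_norm_bound_integral)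
      (auto intro!: integrable_continuous_real continuous_intros cont)
  ultimately show ?thesis by linarith
qed

lemma horizontal_average_le:
  assumes cont: "continuous_on UNIV (\<lambda>x. G (Complex x y))" and h: "0 < h" and N: "0 \<le> N"
    and L2: "(\<integral>\<^sup>+ x. ennreal ((cmod (G (Complex x y)))\<^sup>2) \<partial>lborel) \<le> ennreal (N\<^sup>2)"
  shows "cmod (integral {0..h} (\<lambda>s. G (Complex x y + of_real s))) \<le> N * sqrt h"
proof (rule norm_integral_le_L2[OF _ h N])
  have eq: "Complex x y + of_real s = Complex (x + s) y" for s
    by (simp add: complex_eq_iff)
  show "continuous_on {0..h} (\<lambda>s. G (Complex x y + of_real s))"
    unfolding eq by (rule continuous_on_compose2[OF cont]) (auto intro!: continuous_intros)
  have meas: "(\<lambda>x. ennreal ((cmod (G (Complex x y)))\<^sup>2)) \<in> borel_measurable borel"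
    using borel_measurable_continuous_onI[OF cont] by measurable
  have "(\<integral>\<^sup>+ s. ennreal ((cmod (G (Complex x y + of_real s)))\<^sup>2) * indicator {0..h} s \<partial>lborel)
      \<le> (\<integral>\<^sup>+ s. ennreal ((cmod (G (Complex (x + s) y)))\<^sup>2) \<partial>lborel)"
    unfolding eq by (intro nn_integral_mono) (auto simp: indicator_def)
  also have "\<dots> = (\<integral>\<^sup>+ x. ennreal ((cmod (G (Complex x y)))\<^sup>2) \<partial>lborel)"
    using nn_integral_real_affine[OF meas, of 1 x] by simp
  finally show "(\<integral>\<^sup>+ s. ennreal ((cmod (G (Complex x y + of_real s)))\<^sup>2) * indicator {0..h} s \<partial>lborel)
      \<le> ennreal (N\<^sup>2)"
    using L2 by simp
qed

lemma open_upper_half_plane: "open upper_half_plane"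
  by (simp add: open_halfspace_Im_gt)

lemma convex_upper_half_plane: "convex upper_half_plane"
  by (simp add: convex_halfspace_Im_gt)

text \<open>A half-plane is convex, so \<open>F\<close> has a primitive there. It turns the horizontal integrals of
  \<open>F\<close> into differences, which are visibly holomorphic in the base point and have derivative
  \<open>F (w + s) - F w\<close>.\<close>
lemma horizontal_average_primitive:
  assumes "F holomorphic_on upper_half_plane"
  obtains P where
    "\<And>w. w \<in> upper_half_plane \<Longrightarrow> (P has_field_derivative F w) (at w)"
    "\<And>w s. w \<in> upper_half_plane \<Longrightarrow> 0 \<le> s \<Longrightarrow>
       ((\<lambda>u. F (w + of_real u)) has_integral (P (w + of_real s) - P w)) {0..s}"
proof -
  obtain P where P: "\<And>w. w \<in> upper_half_plane \<Longrightarrow>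
      (P has_field_derivative F w) (at w within upper_half_plane)"
    using holomorphic_convex_primitive'[OF convex_upper_half_plane open_upper_half_plane assms]
    by blast
  have P': "(P has_field_derivative F w) (at w)" if "w \<in> upper_half_plane" for w
    using P[OF that] that open_upper_half_plane at_within_open by metis
  show ?thesis
  proof (rule that[OF P'])
    fix w :: complex and s :: real
    assume w: "w \<in> upper_half_plane" and s: "0 \<le> s"
    have "((\<lambda>u. F (w + of_real u)) has_integral (P (w + of_real s) - P (w + of_real 0))) {0..s}"
    proof (rule fundamental_theorem_of_calculus[OF s])
      fix u :: real
      have "((\<lambda>u::real. w + of_real u) has_vector_derivative 1) (at u within {0..s})"
        by (auto intro!: derivative_eq_intros)
      moreover have "(P has_field_derivative F (w + of_real u))
          (at (w + of_real u) within (\<lambda>u. w + of_real u) ` {0..s})"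
        using P'[of "w + of_real u"] w by (simp add: has_field_derivative_at_within)
      ultimately show "((\<lambda>u. P (w + of_real u)) has_vector_derivative F (w + of_real u))
          (at u within {0..s})"
        using field_vector_diff_chain_within[of "\<lambda>u. w + of_real u" 1 u "{0..s}" P]
        by (simp add: o_def)
    qed
    then show "((\<lambda>u. F (w + of_real u)) has_integral (P (w + of_real s) - P w)) {0..s}"
      by simp
  qed
qed

text \<open>The average of \<open>F\<close> over a horizontal segment of length \<open>h\<close> is at most \<open>N / sqrt h\<close>, so it
  suffices that \<open>F\<close> does not vary much along the segment. But \<open>F (w + s) - F w\<close> is the derivative in
  \<open>w\<close> of the horizontal integral of length \<open>s\<close>, which is bounded by \<open>N * sqrt s\<close> on the whole
  half-plane; Cauchy's estimate bounds that derivative. The length \<open>h = Im w\<close> balances both terms.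
  This yields the growth bound for Hardy space functions with one-dimensional integrals only.\<close>
lemma pointwise_bound_of_horizontal_averages:
  assumes hol: "F holomorphic_on upper_half_plane"
    and avg: "\<And>w h. w \<in> upper_half_plane \<Longrightarrow> 0 < h \<Longrightarrow>
        cmod (integral {0..h} (\<lambda>s. F (w + of_real s))) \<le> N * sqrt h"
    and w: "w \<in> upper_half_plane"
  shows "cmod (F w) \<le> 3 * N / sqrt (Im w)"
proof -
  define y where "y = Im w"
  have y: "0 < y" using w by (simp add: y_def)
  have N: "0 \<le> N"
  proof -
    have "0 \<le> N * sqrt 1" by (rule order_trans[OF norm_ge_zero avg[OF w]]) simp
    then show ?thesis by simp
  qed
  obtain P where P: "\<And>w. w \<in> upper_half_plane \<Longrightarrow> (P has_field_derivative F w) (at w)"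
    and PI: "\<And>w s. w \<in> upper_half_plane \<Longrightarrow> 0 \<le> s \<Longrightarrow>
       ((\<lambda>u. F (w + of_real u)) has_integral (P (w + of_real s) - P w)) {0..s}"
    using horizontal_average_primitive[OF hol] by blast
  \<comment> \<open>Cauchy's estimate on a disc of radius \<open>y / 2\<close>, which stays in the
    half-plane.\<close>
  have diff: "cmod (F (w + of_real s) - F w) \<le> 2 * N * sqrt y / y" if s: "s \<in> {0..y}" for s
  proof (cases "s = 0")
    case False
    define \<Phi> where "\<Phi> v = P (v + of_real s) - P v" for v
    have der: "(\<Phi> has_field_derivative (F (v + of_real s) - F v)) (at v)"
      if "v \<in> upper_half_plane" for v
      unfolding \<Phi>_def
      by (intro DERIV_diff DERIV_shift[THEN iffD1] P) (use that in auto)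
    have sub: "cball w (y/2) \<subseteq> upper_half_plane"
    proof
      fix v assume "v \<in> cball w (y/2)"
      then have "\<bar>Im (w - v)\<bar> \<le> y/2" using abs_Im_le_cmod[of "w - v"] unfolding mem_cball dist_norm by linarith
      then have "y - Im v \<le> y/2" unfolding minus_complex.sel y_def by linarith
      then have "0 < Im v" using y by linarith
      then show "v \<in> upper_half_plane" by simp
    qed
    have hol\<Phi>: "\<Phi> holomorphic_on upper_half_plane"
      using der open_upper_half_plane by (subst holomorphic_on_open) blast+
    have "cmod ((deriv ^^ 1) \<Phi> w) \<le> fact 1 * (N * sqrt s) / (y/2)^1"
    proof (rule Cauchy_inequality)
      show "\<Phi> holomorphic_on ball w (y/2)"
        using hol\<Phi> sub by (meson ball_subset_cball holomorphic_on_subset order_trans)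
      show "continuous_on (cball w (y/2)) \<Phi>"
        using hol\<Phi> sub holomorphic_on_imp_continuous_on continuous_on_subset by blast
      fix v assume "cmod (w - v) = y/2"
      then have v: "v \<in> upper_half_plane" using sub by (auto simp: dist_norm)
      have "\<Phi> v = integral {0..s} (\<lambda>u. F (v + of_real u))"
        using PI[OF v, of s] s unfolding \<Phi>_def by (simp add: integral_unique)
      then show "cmod (\<Phi> v) \<le> N * sqrt s"
        using avg[OF v, of s] s False by simp
    qed (use y in simp)
    moreover have "deriv \<Phi> w = F (w + of_real s) - F w"
      using der[OF w] by (rule DERIV_imp_deriv)
    ultimately have "cmod (F (w + of_real s) - F w) \<le> 2 * N * sqrt s / y"
      by (simp add: mult_ac)
    also have "\<dots> \<le> 2 * N * sqrt y / y"
      using s y N by (intro divide_right_mono mult_left_mono) auto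
    finally show ?thesis .
  qed (use y N in simp)
  have I1: "((\<lambda>s. F (w + of_real s)) has_integral (integral {0..y} (\<lambda>s. F (w + of_real s)))) {0..y}"
    using PI[OF w, of y] y by (auto simp: integral_unique)
  have I2: "((\<lambda>s. F w) has_integral (of_real y * F w)) {0..y}"
    using has_integral_const_real[of "F w" 0 y] y by (simp add: scaleR_conv_of_real)
  have "((\<lambda>s. F (w + of_real s) - F w) has_integral
      (integral {0..y} (\<lambda>s. F (w + of_real s)) - of_real y * F w)) {0..y}"
    by (rule has_integral_diff[OF I1 I2])
  then have "cmod (integral {0..y} (\<lambda>s. F (w + of_real s)) - of_real y * F w)
      \<le> 2 * N * sqrt y / y * y"
    using has_integral_bound_real[of "2 * N * sqrt y / y" "{}" "\<lambda>s. F (w + of_real s) - F w" _ 0 y] diff y N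
    by auto
  moreover have "cmod (of_real y * F w) \<le> cmod (integral {0..y} (\<lambda>s. F (w + of_real s)))
     + cmod (integral {0..y} (\<lambda>s. F (w + of_real s)) - of_real y * F w)"
    using norm_triangle_sub norm_minus_commute by metis
  ultimately have "y * cmod (F w) \<le> 3 * N * sqrt y"
    using avg[OF w y] y by (simp add: norm_mult)
  then have "cmod (F w) \<le> 3 * N * (sqrt y / y)" using y by (simp add: field_simps)
  also have "sqrt y / y = 1 / sqrt y" using y by (simp add: field_simps)
  finally show ?thesis by (simp add: y_def)
qed

text \<open>Phragmen-Lindelof: dividing by \<open>1 - \<i> \<delta> z\<close>, which has modulus at least \<open>1\<close> and at least
  \<open>\<delta> * cmod z\<close> on the closed half-plane, makes a bounded function small on large semicircles without
  increasing it on the real line. The maximum principle on a half-disc applies, and then \<open>\<delta>\<close> tends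
  to \<open>0\<close>.\<close>
lemma bounded_half_plane_maximum_principle:
  assumes hol: "\<Phi> holomorphic_on upper_half_plane"
    and cont: "continuous_on {z. 0 \<le> Im z} \<Phi>"
    and bdd: "\<And>z. 0 \<le> Im z \<Longrightarrow> cmod (\<Phi> z) \<le> B"
    and bdry: "\<And>t::real. cmod (\<Phi> (of_real t)) \<le> N"
    and w: "w \<in> upper_half_plane"
  shows "cmod (\<Phi> w) \<le> N"
proof -
  have N: "0 \<le> N" by (rule order_trans[OF norm_ge_zero bdry[of 0]])
  have B: "0 \<le> B" by (rule order_trans[OF norm_ge_zero bdd[of 0]]) simp
  have est: "cmod (\<Phi> w) \<le> (N + \<delta>) * (1 + \<delta> * cmod w)" if \<delta>: "0 < \<delta>" for \<delta>
  proof -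
    define m where "m v = 1 - \<i> * of_real \<delta> * v" for v
    have m1: "1 \<le> cmod (m v)" if "0 \<le> Im v" for v
      using complex_Re_le_cmod[of "m v"] that \<delta> unfolding m_def
      by (simp, smt (verit) mult_nonneg_nonneg)
    then have m0: "m v \<noteq> 0" if "0 \<le> Im v" for v
      using that by force
    have m2: "\<delta> * cmod v \<le> cmod (m v)" if "0 \<le> Im v" for v
    proof (rule power2_le_imp_le)
      have "(cmod (m v))\<^sup>2 = (1 + \<delta> * Im v)\<^sup>2 + (\<delta> * Re v)\<^sup>2"
        unfolding m_def by (simp add: cmod_power2)
      also have "\<dots> \<ge> (\<delta> * Im v)\<^sup>2 + (\<delta> * Re v)\<^sup>2"
        using that \<delta> by (intro add_right_mono power_mono) auto
      finally show "(\<delta> * cmod v)\<^sup>2 \<le> (cmod (m v))\<^sup>2"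
        by (simp add: power_mult_distrib cmod_power2 algebra_simps)
    qed simp
    \<comment> \<open>beyond this radius the bound \<open>B\<close> divided by \<open>\<delta> *
      R\<close> is below \<open>N + \<delta>\<close>\<close>
    define R where "R = max (cmod w + 1) (B / (\<delta> * (N + \<delta>)))"
    have R: "cmod w < R" "B \<le> R * (\<delta> * (N + \<delta>))" "0 < R"
    proof -
      show "cmod w < R" unfolding R_def by linarith
      then show "0 < R" using norm_ge_zero order_le_less_trans by blast
      have "B / (\<delta> * (N + \<delta>)) \<le> R" unfolding R_def by linarith
      then show "B \<le> R * (\<delta> * (N + \<delta>))" using N \<delta> by (simp add: pos_divide_le_eq)
    qed
    define S where "S = ball 0 R \<inter> upper_half_plane"
    have openS: "open S" unfolding S_def by (intro open_Int open_ball open_upper_half_plane)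
    have clS: "closure S \<subseteq> {z. 0 \<le> Im z}"
      by (rule closure_minimal) (auto simp: S_def closed_halfspace_Im_ge)
    have "cmod (\<Phi> w / m w) \<le> N + \<delta>"
    proof (rule maximum_modulus_frontier[of "\<lambda>v. \<Phi> v / m v" S])
      show "(\<lambda>v. \<Phi> v / m v) holomorphic_on interior S"
        unfolding interior_open[OF openS]
        by (intro holomorphic_intros holomorphic_on_subset[OF hol])
          (auto simp: S_def m_def intro!: holomorphic_intros dest: m0[unfolded m_def, OF less_imp_le])
      show "continuous_on (closure S) (\<lambda>v. \<Phi> v / m v)"
        by (intro continuous_on_divide continuous_on_subset[OF cont clS])
          (use clS m0 in \<open>auto simp: m_def intro!: continuous_intros\<close>)
      show "bounded S" unfolding S_def by (simp add: bounded_Int)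
      show "w \<in> S" using w R by (simp add: S_def)
      fix v assume v: "v \<in> frontier S"
      then have v0: "0 \<le> Im v" using clS by (auto simp: frontier_def)
      have "v \<notin> S" using v openS by (simp add: frontier_def interior_open)
      then consider "Im v = 0" | "R \<le> cmod v" using v0 by (force simp: S_def)
      then show "cmod (\<Phi> v / m v) \<le> N + \<delta>"
      proof cases
        case 1
        then have "v = of_real (Re v)" by (simp add: complex_eq_iff)
        then have "cmod (\<Phi> v) \<le> N" using bdry[of "Re v"] by metis
        also have "\<dots> \<le> (N + \<delta>) * cmod (m v)"
          using mult_mono[OF _ m1[OF v0], of N "N + \<delta>"] N \<delta> by simp
        finally show ?thesis using m0[OF v0] by (simp add: norm_divide pos_divide_le_eq)
      next
        case 2
        have "cmod (\<Phi> v) \<le> R * (\<delta> * (N + \<delta>))" using bdd[OF v0] R by linarith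
        also have "\<dots> \<le> cmod v * (\<delta> * (N + \<delta>))"
          using 2 N \<delta> by (intro mult_right_mono) auto
        also have "\<dots> = (N + \<delta>) * (\<delta> * cmod v)" by (simp add: algebra_simps)
        also have "\<dots> \<le> (N + \<delta>) * cmod (m v)"
          using m2[OF v0] N \<delta> by (intro mult_left_mono) auto
        finally show ?thesis using m0[OF v0] by (simp add: norm_divide pos_divide_le_eq)
      qed
    qed
    then have "cmod (\<Phi> w) \<le> (N + \<delta>) * cmod (m w)"
      using m0[of w] w by (simp add: norm_divide pos_divide_le_eq)
    also have "\<dots> \<le> (N + \<delta>) * (1 + \<delta> * cmod w)"
    proof (rule mult_left_mono)
      show "cmod (m w) \<le> 1 + \<delta> * cmod w"
        using norm_triangle_ineq4[of 1 "\<i> * of_real \<delta> * w"] \<delta> by (simp add: m_def norm_mult)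
    qed (use N \<delta> in simp)
    finally show ?thesis .
  qed
  have "((\<lambda>\<delta>. (N + \<delta>) * (1 + \<delta> * cmod w)) \<longlongrightarrow> (N + 0) * (1 + 0 * cmod w)) (at_right 0)"
    by (intro tendsto_intros)
  then have "((\<lambda>\<delta>. (N + \<delta>) * (1 + \<delta> * cmod w)) \<longlongrightarrow> N) (at_right 0)" by simp
  then show ?thesis
    by (rule tendsto_lowerbound)
      (auto intro!: est eventually_at_right_less[THEN eventually_mono])
qed

text \<open>The values of a Hardy space function are controlled by its boundary \<open>L\<^sup>2\<close> norm \<open>N\<close>, although
  its norms on horizontal lines are only known to be bounded by some \<open>M\<close>. The horizontal integrals of
  fixed length are bounded by \<open>max M N * sqrt h\<close> everywhere and by \<open>N * sqrt h\<close> on the real line;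
  the maximum principle improves the former bound to the latter, and the constant \<open>M\<close> disappears.\<close>
lemma half_plane_bound_by_boundary_L2:
  assumes hol: "G holomorphic_on upper_half_plane"
    and cont: "continuous_on {z. 0 \<le> Im z} G"
    and M: "0 \<le> M" "\<And>y. 0 < y \<Longrightarrow> (\<integral>\<^sup>+ x. ennreal ((cmod (G (Complex x y)))\<^sup>2) \<partial>lborel) \<le> ennreal (M\<^sup>2)"
    and N: "0 \<le> N" "(\<integral>\<^sup>+ x. ennreal ((cmod (G (Complex x 0)))\<^sup>2) \<partial>lborel) \<le> ennreal (N\<^sup>2)"
    and w: "w \<in> upper_half_plane"
  shows "cmod (G w) \<le> 3 * N / sqrt (Im w)"
proof (rule pointwise_bound_of_horizontal_averages[OF hol _ w])
  fix w :: complex and h :: real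
  assume w: "w \<in> upper_half_plane" and h: "0 < h"
  define \<Phi> where "\<Phi> v = integral {0..h} (\<lambda>s. G (v + of_real s))" for v
  have line: "continuous_on UNIV (\<lambda>x. G (Complex x y))" if "0 \<le> y" for y
    by (rule continuous_on_compose2[OF cont]) (use that in \<open>auto simp: Complex_eq intro!: continuous_intros\<close>)
  have real: "cmod (\<Phi> (of_real t)) \<le> N * sqrt h" for t
    using horizontal_average_le[OF line h N, of t] by (simp add: \<Phi>_def complex_of_real_def)
  obtain P where P: "\<And>w. w \<in> upper_half_plane \<Longrightarrow> (P has_field_derivative G w) (at w)"
    and PI: "\<And>w s. w \<in> upper_half_plane \<Longrightarrow> 0 \<le> s \<Longrightarrow>
       ((\<lambda>u. G (w + of_real u)) has_integral (P (w + of_real s) - P w)) {0..s}"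
    using horizontal_average_primitive[OF hol] by blast
  have "cmod (\<Phi> w) \<le> N * sqrt h"
  proof (rule bounded_half_plane_maximum_principle[where \<Phi> = \<Phi> and w = w and B = "max M N * sqrt h"])
    show "w \<in> upper_half_plane" by fact
    show "cmod (\<Phi> (of_real t)) \<le> N * sqrt h" for t by (rule real)
    have holP: "P holomorphic_on upper_half_plane"
      using P open_upper_half_plane by (subst holomorphic_on_open) blast+
    have "(P \<circ> (\<lambda>v. v + of_real h)) holomorphic_on upper_half_plane"
      by (rule holomorphic_on_compose_gen[OF _ holP]) (auto intro!: holomorphic_intros)
    from holomorphic_on_diff[OF this holP]
    have "(\<lambda>v. P (v + of_real h) - P v) holomorphic_on upper_half_plane"
      by (simp add: o_def)
    then show "\<Phi> holomorphic_on upper_half_plane"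
      by (rule holomorphic_transform)
        (use PI h in \<open>force simp: \<Phi>_def intro!: integral_unique[symmetric]\<close>)
    have "continuous_on ({z. 0 \<le> Im z} \<times> cbox 0 h) (\<lambda>(v, s). G (v + of_real s))"
      unfolding split_def
      by (rule continuous_on_compose2[OF cont]) (auto intro!: continuous_intros)
    then show "continuous_on {z. 0 \<le> Im z} \<Phi>"
      using integral_continuous_on_param[where U="{z. 0 \<le> Im z}" and a=0 and b=h and f="\<lambda>v s. G (v + of_real s)"]
      by (simp add: \<Phi>_def[abs_def])
    fix v :: complex assume v: "0 \<le> Im v"
    show "cmod (\<Phi> v) \<le> max M N * sqrt h"
    proof (cases "Im v = 0")
      case True
      then have "v = of_real (Re v)" by (simp add: complex_eq_iff)
      then have "cmod (\<Phi> v) \<le> N * sqrt h" using real by metis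
      also have "\<dots> \<le> max M N * sqrt h" using h by (intro mult_right_mono) auto
      finally show ?thesis .
    next
      case False
      then have "cmod (\<Phi> v) \<le> M * sqrt h"
        using horizontal_average_le[OF line[of "Im v"] h M(1) M(2), of "Re v"] v
        by (simp add: \<Phi>_def)
      also have "\<dots> \<le> max M N * sqrt h" using h by (intro mult_right_mono) auto
      finally show ?thesis .
    qed
  qed
  then show "cmod (integral {0..h} (\<lambda>s. G (w + of_real s))) \<le> N * sqrt h"
    by (simp add: \<Phi>_def)
qed

section \<open>Point evaluations on a de Branges space\<close>

text \<open>At a real zero \<open>z\<close> of \<open>E\<close> the quotient is meromorphic, and its growth at most
  \<open>A / sqrt (Im v)\<close> at \<open>v\<close> straight above \<open>z\<close> is too slow for a pole, the mildest of which grows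
  like \<open>1 / Im v\<close>. So the singularity is removable.\<close>
lemma quotient_extends_to_real_line:
  assumes f: "f holomorphic_on UNIV" and E: "E holomorphic_on UNIV"
    and E0: "\<And>z. z \<in> upper_half_plane \<Longrightarrow> E z \<noteq> 0"
    and bd: "\<And>z. z \<in> upper_half_plane \<Longrightarrow> cmod (f z / E z) \<le> A / sqrt (Im z)"
  obtains G where "G holomorphic_on upper_half_plane" "continuous_on {z. 0 \<le> Im z} G"
    "\<And>z. E z \<noteq> 0 \<Longrightarrow> G z = f z / E z"
proof -
  define F where "F z = f z / E z" for z
  have ana: "f analytic_on {z}" "E analytic_on {z}" for z
    using f E analytic_on_open analytic_on_subset by (metis open_UNIV subset_UNIV)+
  have anaF: "F analytic_on {z}" if "E z \<noteq> 0" for z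
    unfolding F_def by (intro analytic_on_divide ana) (use that in auto)
  have mero: "F meromorphic_on {z}" for z
    unfolding F_def by (intro meromorphic_intros analytic_on_imp_meromorphic_on ana)
  have rs: "remove_sings F analytic_on {z}" if "0 \<le> Im z" for z
  proof (cases "E z = 0")
    case False
    then show ?thesis using anaF by (intro remove_sings_analytic_on)
  next
    case True
    then have Imz: "Im z = 0" using E0[of z] that by force
    \<comment> \<open>\<open>g\<close> is meromorphic at \<open>z\<close> and tends to \<open>0\<close>
      along the vertical ray, hence tends to \<open>0\<close> from all sides; then \<open>F\<close> is
      the difference quotient of a holomorphic function.\<close>
    define g where "g v = (v - z) * F v" for v
    have merog: "g meromorphic_on {z}"
      unfolding g_def by (intro meromorphic_intros mero)
    have iso: "isolated_singularity_at g z" and ness: "not_essential g z"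
      using merog by (auto intro: meromorphic_on_isolated_singularity meromorphic_on_not_essential)
    have path: "filterlim (\<lambda>y::real. z + \<i> * of_real y) (at z) (at_right 0)"
      unfolding filterlim_at
    proof
      show "\<forall>\<^sub>F y::real in at_right 0. z + \<i> * of_real y \<in> UNIV \<and> z + \<i> * of_real y \<noteq> z"
        using eventually_at_right_less[of "0::real"] by eventually_elim simp
      have "((\<lambda>y::real. z + \<i> * of_real y) \<longlongrightarrow> z + \<i> * of_real 0) (at_right 0)"
        by (intro tendsto_intros)
      then show "((\<lambda>y::real. z + \<i> * of_real y) \<longlongrightarrow> z) (at_right 0)" by simp
    qed
    have g0: "((\<lambda>y::real. g (z + \<i> * of_real y)) \<longlongrightarrow> 0) (at_right 0)"
    proof (rule Lim_null_comparison)
      show "\<forall>\<^sub>F y in at_right 0. cmod (g (z + \<i> * of_real y)) \<le> A * sqrt y"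
        using eventually_at_right_less[of "0::real"]
      proof eventually_elim
        case (elim y)
        then have "cmod (g (z + \<i> * of_real y)) \<le> y * (A / sqrt y)"
          using bd[of "z + \<i> * of_real y"] Imz unfolding g_def F_def norm_mult
          by (intro mult_mono) (auto simp: norm_mult)
        also have "y * (A / sqrt y) = A * (y / sqrt y)" by simp
        also have "y / sqrt y = sqrt y" using elim by (simp add: real_div_sqrt)
        finally show ?case .
      qed
      have "((\<lambda>y. A * sqrt y) \<longlongrightarrow> A * sqrt 0) (at_right 0)"
        by (intro tendsto_intros)
      then show "((\<lambda>y. A * sqrt y) \<longlongrightarrow> 0) (at_right 0)" by simp
    qed
    have "\<not> is_pole g z"
    proof
      assume "is_pole g z"
      then have "filterlim (\<lambda>y::real. g (z + \<i> * of_real y)) at_infinity (at_right 0)"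
        unfolding is_pole_def using path by (rule filterlim_compose)
      then show False
        using g0 not_tendsto_and_filterlim_at_infinity trivial_limit_at_right_real by blast
    qed
    then obtain c where c: "g \<midarrow>z\<rightarrow> c" using ness unfolding not_essential_def by blast
    have "((\<lambda>y::real. g (z + \<i> * of_real y)) \<longlongrightarrow> c) (at_right 0)"
      using c path by (rule filterlim_compose)
    then have "c = 0" using g0 tendsto_unique trivial_limit_at_right_real by blast
    define k where "k = remove_sings g"
    have kana: "k analytic_on {z}" and k0: "k z = 0"
      using remove_sings_analytic_at[OF iso c] c \<open>c = 0\<close> by (auto simp: k_def)
    obtain D where "(k has_field_derivative D) (at z)"
      using kana analytic_on_imp_differentiable_at[of k "{z}" z]
      unfolding field_differentiable_def by blast
    then have "((\<lambda>v. (k v - k z) / (v - z)) \<longlongrightarrow> D) (at z)"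
      by (simp add: has_field_derivative_iff)
    moreover have "\<forall>\<^sub>F v in at z. (k v - k z) / (v - z) = F v"
      using eventually_remove_sings_eq_at[OF iso] eventually_neq_at_within[of z z]
      by eventually_elim (simp add: k_def[symmetric] k0, simp add: g_def)
    ultimately have "F \<midarrow>z\<rightarrow> D"
      using tendsto_cong by fast
    then show ?thesis
      using mero meromorphic_on_isolated_singularity by (intro remove_sings_analytic_at) auto
  qed
  then have ana': "remove_sings F analytic_on {z. 0 \<le> Im z}"
    by (subst analytic_on_analytic_at) simp
  show ?thesis
  proof (rule that[of "remove_sings F"])
    show "remove_sings F holomorphic_on upper_half_plane"
      using ana' by (rule analytic_imp_holomorphic[OF analytic_on_subset]) auto
    show "continuous_on {z. 0 \<le> Im z} (remove_sings F)"
      using ana' by (intro holomorphic_on_imp_continuous_on analytic_imp_holomorphic)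
    show "remove_sings F z = f z / E z" if "E z \<noteq> 0" for z
      using anaF[OF that] by (simp add: F_def)
  qed
qed

lemma hermite_biehler_nonzero:
  assumes "hermite_biehler E" "z \<in> upper_half_plane"
  shows "E z \<noteq> 0"
  using assms unfolding hermite_biehler_def by force

text \<open>\<open>E\<close> is not constant, as its moduli at \<open>\<i>\<close> and \<open>- \<i>\<close> differ, so it has countably many zeros.\<close>
lemma hermite_biehler_real_zeros_null:
  assumes "hermite_biehler E"
  shows "AE x in lborel. E (of_real x) \<noteq> 0"
proof -
  have hol: "E holomorphic_on UNIV" using assms by (simp add: hermite_biehler_def)
  have "\<i> \<in> upper_half_plane" by simp
  then have "cmod (E (cnj \<i>)) < cmod (E \<i>)"
    using assms unfolding hermite_biehler_def by blast
  then have "\<not> E constant_on UNIV"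
    unfolding constant_on_def by (metis UNIV_I less_irrefl)
  then have "countable {z \<in> UNIV. E z = 0}"
    by (intro holomorphic_countable_zeros[OF hol] open_UNIV connected_UNIV fsigma_UNIV)
  then have "countable (complex_of_real ` (complex_of_real -` {z. E z = 0}))"
    by (rule countable_subset[rotated]) auto
  then have "countable (complex_of_real -` {z. E z = 0})"
    by (rule countable_image_inj_on) (simp add: inj_on_def)
  then have "complex_of_real -` {z. E z = 0} \<in> null_sets lborel"
    by (rule countable_imp_null_set_lborel)
  then show ?thesis
    by (rule AE_not_in[THEN AE_mp]) simp
qed

lemma hardy_H2_bound:
  assumes "F \<in> hardy_H2"
  obtains M where "0 \<le> M"
    "\<And>y. 0 < y \<Longrightarrow> (\<integral>\<^sup>+ x. ennreal ((cmod (F (Complex x y)))\<^sup>2) \<partial>lborel) \<le> ennreal (M\<^sup>2)"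
proof -
  define S where "S = (SUP y\<in>{0<..}. \<integral>\<^sup>+ x. ennreal ((cmod (F (Complex x y)))\<^sup>2) \<partial>lborel)"
  have "S < \<infinity>" using assms by (simp add: hardy_H2_def S_def)
  then have "ennreal ((sqrt (enn2real S))\<^sup>2) = S" by simp
  moreover have "(\<integral>\<^sup>+ x. ennreal ((cmod (F (Complex x y)))\<^sup>2) \<partial>lborel) \<le> S" if "0 < y" for y
    unfolding S_def by (rule SUP_upper) (use that in simp)
  ultimately show ?thesis
    by (intro that[of "sqrt (enn2real S)"]) auto
qed

lemma sharp_sharp: "sharp (sharp f) = f"
  by (simp add: sharp_def fun_eq_iff)

lemma sharp_of_real: "cmod (sharp f (of_real t)) = cmod (f (of_real t))"
  by (simp add: sharp_def)

lemma sharp_in_de_Branges: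
  assumes "f \<in> de_Branges E"
  shows "sharp f \<in> de_Branges E"
proof -
  have "f holomorphic_on UNIV" using assms by (simp add: de_Branges_def)
  then have "(cnj \<circ> f \<circ> cnj) holomorphic_on UNIV"
    by (subst holomorphic_on_compose_cnj_cnj) auto
  then have "sharp f holomorphic_on UNIV"
    by (simp add: o_def sharp_def[abs_def])
  then show ?thesis using assms by (simp add: de_Branges_def sharp_sharp)
qed

lemma dB_norm_eq:
  "dB_norm E f = sqrt (LINT t|lborel. (cmod (f (of_real t) / E (of_real t)))\<^sup>2)"
proof -
  have "f (of_real t) * cnj (f (of_real t)) / of_real ((cmod (E (of_real t)))\<^sup>2)
      = complex_of_real ((cmod (f (of_real t) / E (of_real t)))\<^sup>2)" for t
    using complex_norm_square[of "f (of_real t)"] by (simp add: norm_divide power_divide)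
  then show ?thesis
    unfolding dB_norm_def dB_inner_def by (simp only: integral_complex_of_real Re_complex_of_real)
qed

lemma dB_norm_sharp: "dB_norm E (sharp f) = dB_norm E f"
  by (simp add: dB_norm_eq norm_divide sharp_of_real)

lemma dB_norm_nonneg: "0 \<le> dB_norm E f"
  by (simp add: dB_norm_eq)

text \<open>\<open>f / E\<close> extends continuously to the real line, and by Fatou's lemma its boundary values are
  square integrable. The integral in the definition of the norm therefore converges (a divergent one
  would have the default value \<open>0\<close>) and equals the boundary \<open>L\<^sup>2\<close> norm of the extension.\<close>
lemma de_Branges_bound_upper:
  assumes HB: "hermite_biehler E" and f: "f \<in> de_Branges E" and w: "w \<in> upper_half_plane"
  shows "cmod (f w) \<le> cmod (E w) * (3 * dB_norm E f / sqrt (Im w))"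
proof -
  define F where "F z = f z / E z" for z
  have holf: "f holomorphic_on UNIV" and F: "F \<in> hardy_H2"
    using f by (auto simp: de_Branges_def F_def[abs_def])
  have holE: "E holomorphic_on UNIV" using HB by (simp add: hermite_biehler_def)
  note E0 = hermite_biehler_nonzero[OF HB]
  have contf: "continuous_on UNIV f" and contE: "continuous_on UNIV E"
    using holf holE by (auto intro: holomorphic_on_imp_continuous_on)
  obtain M where M: "0 \<le> M"
    "\<And>y. 0 < y \<Longrightarrow> (\<integral>\<^sup>+ x. ennreal ((cmod (F (Complex x y)))\<^sup>2) \<partial>lborel) \<le> ennreal (M\<^sup>2)"
    using hardy_H2_bound[OF F] by blast
  have holF: "F holomorphic_on upper_half_plane"
    using F by (simp add: hardy_H2_def)
  have "cmod (F z) \<le> 3 * M / sqrt (Im z)" if "z \<in> upper_half_plane" for z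
  proof (rule pointwise_bound_of_horizontal_averages[OF holF _ that])
    fix v :: complex and h :: real
    assume v: "v \<in> upper_half_plane" and h: "0 < h"
    have "continuous_on UNIV (\<lambda>x. F (Complex x (Im v)))"
      by (rule continuous_on_compose2[OF holomorphic_on_imp_continuous_on[OF holF]])
        (use v in \<open>auto simp: Complex_eq intro!: continuous_intros\<close>)
    from horizontal_average_le[OF this h M(1) M(2), of "Re v"]
    show "cmod (integral {0..h} (\<lambda>s. F (v + of_real s))) \<le> M * sqrt h"
      using v by simp
  qed
  then obtain G where G: "G holomorphic_on upper_half_plane" "continuous_on {z. 0 \<le> Im z} G"
    and GF: "\<And>z. E z \<noteq> 0 \<Longrightarrow> G z = F z"
    using quotient_extends_to_real_line[OF holf holE E0, of "3 * M"] unfolding F_def by blast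
  have GM: "(\<integral>\<^sup>+ x. ennreal ((cmod (G (Complex x y)))\<^sup>2) \<partial>lborel) \<le> ennreal (M\<^sup>2)" if "0 < y" for y
    using M(2)[OF that] that by (simp add: GF E0)
  define u where "u x = (cmod (F (of_real x)))\<^sup>2" for x :: real
  have line: "continuous_on UNIV (\<lambda>x. G (Complex x y))" if "0 \<le> y" for y
    by (rule continuous_on_compose2[OF G(2)]) (use that in \<open>auto simp: Complex_eq intro!: continuous_intros\<close>)
  have lim: "liminf (\<lambda>n. ennreal ((cmod (G (Complex x (1 / real (Suc n)))))\<^sup>2))
      = ennreal ((cmod (G (Complex x 0)))\<^sup>2)" for x
  proof (rule lim_imp_Liminf)
    have "(\<lambda>n. Complex x (1 / real (Suc n))) \<longlonglongrightarrow> Complex x 0"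
      using LIMSEQ_Suc[OF lim_1_over_n] by (intro tendsto_Complex tendsto_const) auto
    from continuous_on_tendsto_compose[OF G(2) this]
    have "(\<lambda>n. G (Complex x (1 / real (Suc n)))) \<longlonglongrightarrow> G (Complex x 0)"
      by simp
    then show "(\<lambda>n. ennreal ((cmod (G (Complex x (1 / real (Suc n)))))\<^sup>2))
        \<longlonglongrightarrow> ennreal ((cmod (G (Complex x 0)))\<^sup>2)"
      by (intro tendsto_intros)
  qed simp
  have "(\<integral>\<^sup>+ x. ennreal ((cmod (G (Complex x 0)))\<^sup>2) \<partial>lborel)
      = (\<integral>\<^sup>+ x. liminf (\<lambda>n. ennreal ((cmod (G (Complex x (1 / real (Suc n)))))\<^sup>2)) \<partial>lborel)"
    by (simp only: lim)
  also have "\<dots> \<le> liminf (\<lambda>n. \<integral>\<^sup>+ x. ennreal ((cmod (G (Complex x (1 / real (Suc n)))))\<^sup>2) \<partial>lborel)"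
  proof (rule nn_integral_liminf)
    fix n
    show "(\<lambda>x. ennreal ((cmod (G (Complex x (1 / real (Suc n)))))\<^sup>2)) \<in> borel_measurable lborel"
      using borel_measurable_continuous_onI[OF line[of "1 / real (Suc n)"]] by measurable
  qed
  also have "\<dots> \<le> liminf (\<lambda>n::nat. ennreal (M\<^sup>2))"
    by (intro Liminf_mono always_eventually allI GM) simp
  also have "\<dots> = ennreal (M\<^sup>2)" by (simp add: Liminf_const)
  finally have fin: "(\<integral>\<^sup>+ x. ennreal ((cmod (G (Complex x 0)))\<^sup>2) \<partial>lborel) \<le> ennreal (M\<^sup>2)" .
  have ae: "(\<integral>\<^sup>+ x. ennreal ((cmod (G (Complex x 0)))\<^sup>2) \<partial>lborel) = (\<integral>\<^sup>+ x. ennreal (u x) \<partial>lborel)"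
    using hermite_biehler_real_zeros_null[OF HB]
    by (intro nn_integral_cong_AE) (erule eventually_mono, simp add: u_def GF flip: complex_of_real_def)
  have "continuous_on UNIV (\<lambda>x::real. f (of_real x))" "continuous_on UNIV (\<lambda>x::real. E (of_real x))"
    by (auto intro!: continuous_on_compose2[OF contf] continuous_on_compose2[OF contE]
        continuous_intros)
  then have "(\<lambda>x::real. f (of_real x)) \<in> borel_measurable borel" "(\<lambda>x::real. E (of_real x)) \<in> borel_measurable borel"
    by (auto intro: borel_measurable_continuous_onI)
  then have "u \<in> borel_measurable borel"
    unfolding u_def[abs_def] F_def by measurable
  moreover have "(\<integral>\<^sup>+ x. ennreal (norm (u x)) \<partial>lborel) < \<infinity>"
    using order_le_less_trans[OF fin[unfolded ae] ennreal_less_top] by (simp add: u_def)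
  ultimately have "integrable lborel u"
    by (intro integrableI_bounded) simp_all
  then have "(\<integral>\<^sup>+ x. ennreal (u x) \<partial>lborel) = ennreal (LINT x|lborel. u x)"
    by (rule nn_integral_eq_integral) (simp add: u_def)
  also have "(LINT x|lborel. u x) = (dB_norm E f)\<^sup>2"
    unfolding dB_norm_eq u_def F_def by simp
  finally have N: "(\<integral>\<^sup>+ x. ennreal ((cmod (G (Complex x 0)))\<^sup>2) \<partial>lborel) \<le> ennreal ((dB_norm E f)\<^sup>2)"
    using ae by simp
  have "cmod (G w) \<le> 3 * dB_norm E f / sqrt (Im w)"
    by (rule half_plane_bound_by_boundary_L2[OF G M(1) GM dB_norm_nonneg N w])
  then have "cmod (f w) / cmod (E w) \<le> 3 * dB_norm E f / sqrt (Im w)"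
    unfolding GF[OF E0[OF w]] F_def norm_divide .
  then show ?thesis
    using E0[OF w] mult.commute by (metis pos_divide_le_eq zero_less_norm_iff)
qed

text \<open>The bound in the upper half-plane, applied to \<open>f\<close> and to \<open>sharp f\<close>, controls
  \<open>cmod (f z) * \<bar>Im z\<bar>\<close> on a disc of radius \<open>\<rho>\<close>. It says nothing on the real line itself, but
  \<open>cmod (z\<^sup>2 - \<rho>\<^sup>2) = 2 * \<rho> * \<bar>Im z\<bar>\<close> on the boundary circle, so the maximum principle for
  \<open>f z * (z\<^sup>2 - \<rho>\<^sup>2)\<close> carries the control to the whole disc of half the radius.\<close>
lemma de_Branges_evaluation_locally_bounded:
  assumes HB: "hermite_biehler E"
  obtains C where "0 \<le> C"
    "\<And>f z. f \<in> de_Branges E \<Longrightarrow> cmod z \<le> r \<Longrightarrow> cmod (f z) \<le> C * dB_norm E f"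
proof -
  define \<rho> where "\<rho> = 2 * max r 1"
  have \<rho>: "2 \<le> \<rho>" "r \<le> \<rho> / 2" by (auto simp: \<rho>_def)
  have "E holomorphic_on UNIV" using HB by (simp add: hermite_biehler_def)
  then have "continuous_on (cball 0 \<rho>) E"
    by (rule holomorphic_on_imp_continuous_on[OF holomorphic_on_subset]) simp
  then have "bounded (E ` cball 0 \<rho>)"
    by (intro compact_imp_bounded compact_continuous_image compact_cball)
  then obtain B where B: "0 < B" "\<And>z. cmod z \<le> \<rho> \<Longrightarrow> cmod (E z) \<le> B"
    unfolding bounded_pos by (auto simp: dist_norm)
  have off: "cmod (f z) * \<bar>Im z\<bar> \<le> 3 * B * sqrt \<rho> * dB_norm E f"
    if f: "f \<in> de_Branges E" and z: "cmod z \<le> \<rho>" for f z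
  proof -
    have up: "cmod (g v) * Im v \<le> 3 * B * sqrt \<rho> * dB_norm E g"
      if g: "g \<in> de_Branges E" and v: "cmod v \<le> \<rho>" "0 < Im v" for g v
    proof -
      have "cmod (g v) * Im v \<le> cmod (E v) * (3 * dB_norm E g / sqrt (Im v)) * Im v"
        using de_Branges_bound_upper[OF HB g, of v] v by (intro mult_right_mono) auto
      also have "\<dots> = cmod (E v) * (3 * dB_norm E g) * (Im v / sqrt (Im v))" by simp
      also have "Im v / sqrt (Im v) = sqrt (Im v)" using v by (simp add: real_div_sqrt)
      also have "cmod (E v) * (3 * dB_norm E g) * sqrt (Im v) \<le> B * (3 * dB_norm E g) * sqrt \<rho>"
        using v B dB_norm_nonneg[of E g] abs_Im_le_cmod[of v] by (intro mult_mono) auto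
      finally show ?thesis by (simp add: algebra_simps)
    qed
    consider "0 < Im z" | "Im z = 0" | "Im z < 0" by linarith
    then show ?thesis
    proof cases
      case 1 then show ?thesis using up[OF f z] by simp
    next
      case 2 then show ?thesis using B \<rho> dB_norm_nonneg[of E f] by simp
    next
      case 3
      then show ?thesis
        using up[OF sharp_in_de_Branges[OF f], of "cnj z"] z by (simp add: dB_norm_sharp sharp_def)
    qed
  qed
  define C where "C = 2 * \<rho> * (3 * B * sqrt \<rho>) / (3 / 4 * \<rho>\<^sup>2)"
  show ?thesis
  proof (rule that[of C])
    show "0 \<le> C" using B \<rho> by (simp add: C_def)
    fix f z assume f: "f \<in> de_Branges E" and z: "cmod z \<le> r"
    have holf: "f holomorphic_on UNIV" using f by (simp add: de_Branges_def)
    define g where "g v = f v * (v\<^sup>2 - of_real (\<rho>\<^sup>2))" for v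
    have holg: "g holomorphic_on UNIV"
      unfolding g_def by (intro holomorphic_intros holf)
    have "cmod (g z) \<le> 2 * \<rho> * (3 * B * sqrt \<rho> * dB_norm E f)"
    proof (rule maximum_modulus_frontier[of g "cball 0 \<rho>"])
      show "g holomorphic_on interior (cball 0 \<rho>)"
        using holg by (rule holomorphic_on_subset) simp
      show "continuous_on (closure (cball 0 \<rho>)) g"
        by (rule holomorphic_on_imp_continuous_on[OF holomorphic_on_subset[OF holg]]) simp
      show "z \<in> cball 0 \<rho>" using z \<rho> by simp
      fix v assume "v \<in> frontier (cball (0::complex) \<rho>)"
      then have v: "cmod v = \<rho>" using \<rho> by (simp add: frontier_cball)
      have "of_real (\<rho>\<^sup>2) = v * cnj v"
        using complex_norm_square[of v] unfolding v .
      then have "v\<^sup>2 - of_real (\<rho>\<^sup>2) = v * (v - cnj v)"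
        by (simp only: power2_eq_square right_diff_distrib)
      then have "cmod (v\<^sup>2 - of_real (\<rho>\<^sup>2)) = \<rho> * (2 * \<bar>Im v\<bar>)"
        by (simp only: norm_mult v complex_diff_cnj) (simp add: norm_mult)
      then have "cmod (g v) = 2 * \<rho> * (cmod (f v) * \<bar>Im v\<bar>)"
        unfolding g_def norm_mult by simp
      also have "\<dots> \<le> 2 * \<rho> * (3 * B * sqrt \<rho> * dB_norm E f)"
        using off[OF f, of v] v \<rho> by (intro mult_left_mono) auto
      finally show "cmod (g v) \<le> 2 * \<rho> * (3 * B * sqrt \<rho> * dB_norm E f)" .
    qed simp
    moreover have "3 / 4 * \<rho>\<^sup>2 \<le> cmod (z\<^sup>2 - of_real (\<rho>\<^sup>2))"
    proof -
      have "(cmod z)\<^sup>2 \<le> (\<rho> / 2)\<^sup>2" using z \<rho> by (intro power_mono) auto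
      moreover have "\<rho>\<^sup>2 - (cmod z)\<^sup>2 \<le> cmod (z\<^sup>2 - of_real (\<rho>\<^sup>2))"
        using norm_triangle_ineq2[of "of_real (\<rho>\<^sup>2)" "z\<^sup>2"]
        by (simp add: norm_minus_commute norm_power norm_of_real)
      ultimately show ?thesis by (simp add: power_divide)
    qed
    then have "cmod (f z) * (3 / 4 * \<rho>\<^sup>2) \<le> cmod (g z)"
      unfolding g_def norm_mult by (intro mult_left_mono) auto
    ultimately have "cmod (f z) * (3 / 4 * \<rho>\<^sup>2) \<le> 2 * \<rho> * (3 * B * sqrt \<rho> * dB_norm E f)" by linarith
    then have "cmod (f z) \<le> 2 * \<rho> * (3 * B * sqrt \<rho> * dB_norm E f) / (3 / 4 * \<rho>\<^sup>2)"
      using \<rho> by (subst pos_le_divide_eq) auto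
    then show "cmod (f z) \<le> C * dB_norm E f"
      by (simp add: C_def mult_ac)
  qed
qed

section \<open>Covering of circles by non-affine entire functions\<close>

text \<open>A covering theorem in the spirit of Bohr and Landau. If \<open>\<phi>\<close> omits on \<open>cball 0 r\<close> a point of
  each of the circles of radii \<open>\<rho>\<close> and \<open>2 * \<rho>\<close>, then an affine change of coordinates sends these two
  points to \<open>0\<close> and \<open>1\<close>, and Schottky's theorem bounds \<open>\<phi>\<close> on \<open>cball 0 (r / 2)\<close> by a universal
  multiple of \<open>\<rho>\<close>. The ratio \<open>2\<close> of the radii keeps the two points apart, at a distance comparable
  to \<open>\<rho>\<close>.\<close>
lemma image_contains_circle:
  obtains c :: real where "0 < c"
    "\<And>\<phi> r \<rho> z. \<phi> holomorphic_on UNIV \<Longrightarrow> 0 < r \<Longrightarrow> 0 < \<rho> \<Longrightarrow> cmod (\<phi> 0) \<le> \<rho> \<Longrightarrow>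
       cmod z \<le> r / 2 \<Longrightarrow> c * \<rho> < cmod (\<phi> z) \<Longrightarrow>
       sphere 0 \<rho> \<subseteq> \<phi> ` cball 0 r \<or> sphere 0 (2 * \<rho>) \<subseteq> \<phi> ` cball 0 r"
proof -
  \<comment> \<open>Schottky's constant for functions bounded by \<open>2\<close> at the origin, on the
    disc of radius \<open>1 / 2\<close>.\<close>
  define S where "S = exp (pi * exp (pi * (2 + 2 * 2 + 12 * (1/2) / (1 - 1/2))))"
  have S: "0 < S" by (simp add: S_def)
  show ?thesis
  proof (rule that[of "1 + 3 * S"])
    show "0 < 1 + 3 * S" using S by simp
    fix \<phi> :: "complex \<Rightarrow> complex" and r \<rho> :: real and z :: complex
    assume hol: "\<phi> holomorphic_on UNIV" and r: "0 < r" and \<rho>: "0 < \<rho>"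
      and \<phi>0: "cmod (\<phi> 0) \<le> \<rho>" and z: "cmod z \<le> r / 2" and big: "(1 + 3 * S) * \<rho> < cmod (\<phi> z)"
    show "sphere 0 \<rho> \<subseteq> \<phi> ` cball 0 r \<or> sphere 0 (2 * \<rho>) \<subseteq> \<phi> ` cball 0 r"
    proof (rule ccontr)
      assume "\<not> ?thesis"
      then obtain a b where a: "cmod a = \<rho>" "a \<notin> \<phi> ` cball 0 r"
        and b: "cmod b = 2 * \<rho>" "b \<notin> \<phi> ` cball 0 r"
        unfolding de_Morgan_disj subset_iff mem_sphere_0 by blast
      have ab: "\<rho> \<le> cmod (b - a)" "cmod (b - a) \<le> 3 * \<rho>"
        using norm_triangle_ineq2[of b a] norm_triangle_ineq4[of b a] a b by auto
      then have ab0: "b - a \<noteq> 0" using \<rho> by force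
      define h where "h w = (\<phi> (of_real r * w) - a) / (b - a)" for w
      have in_disc: "\<phi> (of_real r * w) \<in> \<phi> ` cball 0 r" if "w \<in> cball 0 1" for w
        using that r by (intro imageI) (simp add: norm_mult mult_left_le)
      have "cmod (h (z / of_real r)) \<le> S"
        unfolding S_def
      proof (rule Schottky[where f = h and z = "z / of_real r"])
        have "(\<phi> \<circ> (\<lambda>w. of_real r * w)) holomorphic_on cball 0 1"
          by (rule holomorphic_on_compose_gen[OF _ hol]) (auto intro!: holomorphic_intros)
        then show "h holomorphic_on cball 0 1"
          using ab0 unfolding h_def o_def by (intro holomorphic_intros) auto
        have "cmod (\<phi> 0 - a) \<le> 2 * \<rho>"
          using norm_triangle_ineq4[of "\<phi> 0" a] \<phi>0 a by linarith
        also have "\<dots> \<le> 2 * cmod (b - a)" using ab by simp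
        finally show "cmod (h 0) \<le> 2"
          using ab0 by (simp add: h_def norm_divide pos_divide_le_eq)
        show "\<not> (h w = 0 \<or> h w = 1)" if "w \<in> cball 0 1" for w
          using in_disc[OF that] a b ab0 by (auto simp: h_def)
        show "cmod (z / of_real r) \<le> 1 / 2"
          using z r by (simp add: norm_divide pos_divide_le_eq)
      qed auto
      then have "cmod (\<phi> z - a) \<le> S * cmod (b - a)"
        using r ab0 by (simp add: h_def norm_divide pos_divide_le_eq)
      also have "\<dots> \<le> S * (3 * \<rho>)" using ab S by simp
      finally have "cmod (\<phi> z) \<le> \<rho> + S * (3 * \<rho>)"
        using norm_triangle_sub[of "\<phi> z" a] a by linarith
      then show False using big by (simp add: algebra_simps)
    qed
  qed
qed

lemma entire_affine_if_second_deriv_zero: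
  fixes \<phi> :: "complex \<Rightarrow> complex"
  assumes hol: "\<phi> holomorphic_on UNIV" and zero: "\<And>z. (deriv ^^ 2) \<phi> z = 0"
  shows "\<exists>a b. \<forall>z. \<phi> z = a * z + b"
proof -
  have d1: "(\<phi> has_field_derivative deriv \<phi> z) (at z)" for z
    using hol holomorphic_derivI open_UNIV by blast
  have "deriv \<phi> holomorphic_on UNIV"
    using hol by (intro holomorphic_deriv) auto
  then have d2: "(deriv \<phi> has_field_derivative 0) (at z)" for z
    using holomorphic_derivI[of "deriv \<phi>" UNIV z UNIV] zero[of z] by (simp add: numeral_2_eq_2)
  obtain a where a: "\<And>z. deriv \<phi> z = a"
    using has_field_derivative_zero_constant[of UNIV "deriv \<phi>"] d2 by auto
  have "((\<lambda>z. \<phi> z - a * z) has_field_derivative 0) (at z)" for z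
    using d1[of z] by (auto intro!: derivative_eq_intros simp: a)
  then obtain b where "\<And>z. \<phi> z - a * z = b"
    using has_field_derivative_zero_constant[of UNIV "\<lambda>z. \<phi> z - a * z"] by auto
  then have "\<phi> z = a * z + b" for z by (metis diff_add_cancel add.commute)
  then show ?thesis by blast
qed

text \<open>Cauchy's estimate at a point where the second derivative does not vanish shows that the maximum
  of a non-affine \<open>\<phi>\<close> over a disc outgrows every multiple of the radius. So \<open>\<phi> ` cball 0 r\<close> contains
  a circle of radius at least \<open>\<Lambda> * r\<close>, and a bound for \<open>g\<close> on that circle holds inside it.\<close>
lemma nonaffine_entire_pulls_back_bounds:
  fixes \<phi> :: "complex \<Rightarrow> complex"
  assumes hol: "\<phi> holomorphic_on UNIV" and naff: "\<nexists>a b. \<forall>z. \<phi> z = a * z + b"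
    and \<Lambda>: "0 < \<Lambda>"
  obtains r0 where "0 < r0"
    "\<And>r g B w. r0 \<le> r \<Longrightarrow> g holomorphic_on UNIV \<Longrightarrow> (\<And>z. cmod z \<le> r \<Longrightarrow> cmod (g (\<phi> z)) \<le> B) \<Longrightarrow>
       cmod w \<le> \<Lambda> * r \<Longrightarrow> cmod (g w) \<le> B"
proof -
  obtain c where c: "0 < c" and circle:
    "\<And>\<phi> r \<rho> z. \<phi> holomorphic_on UNIV \<Longrightarrow> 0 < r \<Longrightarrow> 0 < \<rho> \<Longrightarrow> cmod (\<phi> 0) \<le> \<rho> \<Longrightarrow>
       cmod z \<le> r / 2 \<Longrightarrow> c * \<rho> < cmod (\<phi> z) \<Longrightarrow>
       sphere 0 \<rho> \<subseteq> \<phi> ` cball 0 r \<or> sphere 0 (2 * \<rho>) \<subseteq> \<phi> ` cball 0 r"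
    using image_contains_circle by metis
  obtain p where p: "(deriv ^^ 2) \<phi> p \<noteq> 0"
    using entire_affine_if_second_deriv_zero[OF hol] naff by blast
  define d where "d = cmod ((deriv ^^ 2) \<phi> p)"
  have d: "0 < d" using p by (simp add: d_def)
  \<comment> \<open>The terms of \<open>r0\<close> serve, in turn, positivity, the inclusion of the disc
    of radius \<open>r / 4\<close> around \<open>p\<close> in the one of radius \<open>r / 2\<close>
    around \<open>0\<close>, the bound on \<open>\<phi> 0\<close>, and the contradiction with Cauchy's
    estimate.\<close>
  define r0 where "r0 = 1 + 4 * cmod p + cmod (\<phi> 0) / \<Lambda> + 32 * c * \<Lambda> / d"
  have nonneg: "0 \<le> cmod (\<phi> 0) / \<Lambda>" "0 \<le> 32 * c * \<Lambda> / d" using c \<Lambda> d by auto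
  show ?thesis
  proof (rule that[of r0])
    show "0 < r0" unfolding r0_def using nonneg norm_ge_zero[of p] by linarith
    fix r B :: real and g :: "complex \<Rightarrow> complex" and w :: complex
    assume r0: "r0 \<le> r" and g: "g holomorphic_on UNIV"
      and gB: "\<And>z. cmod z \<le> r \<Longrightarrow> cmod (g (\<phi> z)) \<le> B" and w: "cmod w \<le> \<Lambda> * r"
    have r: "0 < r" "4 * cmod p \<le> r" and "cmod (\<phi> 0) / \<Lambda> \<le> r" and "32 * c * \<Lambda> / d < r"
      using r0 nonneg norm_ge_zero[of p] unfolding r0_def by linarith+
    then have r': "cmod (\<phi> 0) \<le> \<Lambda> * r" "32 * c * \<Lambda> < r * d"
      using \<Lambda> d by (simp_all add: pos_divide_le_eq pos_divide_less_eq mult.commute)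
    obtain z where z: "cmod z \<le> r / 2" "c * (\<Lambda> * r) < cmod (\<phi> z)"
    proof (rule ccontr)
      assume "\<not> thesis"
      then have small: "cmod (\<phi> z) \<le> c * (\<Lambda> * r)" if "cmod z \<le> r / 2" for z
        using that \<open>\<And>z. cmod z \<le> r / 2 \<Longrightarrow> c * (\<Lambda> * r) < cmod (\<phi> z) \<Longrightarrow> thesis\<close> not_le by blast
      have "cmod ((deriv ^^ 2) \<phi> p) \<le> fact 2 * (c * (\<Lambda> * r)) / (r / 4)^2"
      proof (rule Cauchy_inequality)
        show "\<phi> holomorphic_on ball p (r / 4)" using hol by (rule holomorphic_on_subset) simp
        show "continuous_on (cball p (r / 4)) \<phi>"
          by (rule holomorphic_on_imp_continuous_on[OF holomorphic_on_subset[OF hol]]) simp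
        show "0 < r / 4" using r by simp
        fix x assume "cmod (p - x) = r / 4"
        then have "cmod x \<le> r / 2"
          using norm_triangle_sub[of x p] r by (simp add: norm_minus_commute)
        then show "cmod (\<phi> x) \<le> c * (\<Lambda> * r)" by (rule small)
      qed
      also have "\<dots> = 32 * c * \<Lambda> / r"
        using r by (simp add: power2_eq_square)
      finally have "d * r \<le> 32 * c * \<Lambda>"
        using r by (simp add: d_def pos_le_divide_eq)
      then show False using r' by (simp add: mult.commute)
    qed
    have "\<exists>R. \<Lambda> * r \<le> R \<and> sphere 0 R \<subseteq> \<phi> ` cball 0 r"
    proof -
      have pos: "0 < \<Lambda> * r" using r \<Lambda> by simp
      have "\<Lambda> * r \<le> 2 * (\<Lambda> * r)" using pos by linarith
      then show ?thesis using circle[OF hol r(1) pos r'(1) z] by blast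
    qed
    then obtain R where R: "\<Lambda> * r \<le> R" "sphere 0 R \<subseteq> \<phi> ` cball 0 r" by blast
    show "cmod (g w) \<le> B"
    proof (rule maximum_modulus_frontier[of g "cball 0 R"])
      show "g holomorphic_on interior (cball 0 R)" using g by (rule holomorphic_on_subset) simp
      show "continuous_on (closure (cball 0 R)) g"
        by (rule holomorphic_on_imp_continuous_on[OF holomorphic_on_subset[OF g]]) simp
      show "w \<in> cball 0 R" using w R by simp
      fix v assume "v \<in> frontier (cball (0::complex) R)"
      moreover have "0 < R" using mult_pos_pos[OF \<Lambda> r(1)] R(1) by linarith
      ultimately have "v \<in> sphere 0 R" by (simp add: frontier_cball)
      then obtain u where "v = \<phi> u" "cmod u \<le> r" using R by auto
      then show "cmod (g v) \<le> B" using gB by simp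
    qed simp
  qed
qed

text \<open>Each iteration enlarges the controlled disc by the factor \<open>\<Lambda>\<close>. The induction hypothesis is
  used for \<open>g \<circ> \<phi>\<close>; a bound for \<open>g\<close> on the last disc then follows from \<open>step\<close>.\<close>
lemma iterates_pull_back_bounds:
  fixes \<phi> :: "complex \<Rightarrow> complex"
  assumes hol: "\<phi> holomorphic_on UNIV" and r0: "0 < r0" and \<Lambda>: "1 \<le> \<Lambda>"
    and step: "\<And>r g B w. r0 \<le> r \<Longrightarrow> g holomorphic_on UNIV \<Longrightarrow>
       (\<And>z. cmod z \<le> r \<Longrightarrow> cmod (g (\<phi> z)) \<le> B) \<Longrightarrow> cmod w \<le> \<Lambda> * r \<Longrightarrow> cmod (g w) \<le> B"
    and g: "g holomorphic_on UNIV"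
    and gB: "\<And>z. cmod z \<le> r0 \<Longrightarrow> cmod (g ((\<phi> ^^ n) z)) \<le> B"
    and w: "cmod w \<le> \<Lambda> ^ n * r0"
  shows "cmod (g w) \<le> B"
  using g gB w
proof (induction n arbitrary: g w)
  case 0
  then show ?case by simp
next
  case (Suc n)
  have "(g \<circ> \<phi>) holomorphic_on UNIV"
    by (rule holomorphic_on_compose_gen[OF hol Suc.prems(1)]) simp
  then have "cmod (g (\<phi> z)) \<le> B" if "cmod z \<le> \<Lambda> ^ n * r0" for z
    using Suc.IH[OF \<open>(g \<circ> \<phi>) holomorphic_on UNIV\<close> _ that] Suc.prems(2) by (simp add: o_def)
  moreover have "r0 \<le> \<Lambda> ^ n * r0" using r0 one_le_power[OF \<Lambda>, of n] by simp
  ultimately show ?case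
    using step[of "\<Lambda> ^ n * r0" g B w] Suc.prems(1,3) by (simp add: mult.assoc)
qed

text \<open>The bound grows like \<open>K ^ n\<close> while the radius grows like \<open>(2 * K) ^ n\<close>, so this is growth
  slower than linear; Liouville's argument with the first derivative applies.\<close>
lemma entire_constant_if_slow_on_discs:
  fixes f :: "complex \<Rightarrow> complex"
  assumes hol: "f holomorphic_on UNIV" and r0: "0 < r0" and K: "1 \<le> K"
    and bd: "\<And>n w. cmod w \<le> (2 * K) ^ n * r0 \<Longrightarrow> cmod (f w) \<le> D * K ^ n"
  shows "f constant_on UNIV"
proof -
  have "deriv f w = 0" for w
  proof -
    have "\<forall>\<^sub>F n in sequentially. cmod (deriv f w) \<le> 2 * D / r0 * (1 / 2) ^ n"
    proof -
      obtain m where "2 * cmod w / r0 < 2 ^ m"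
        using real_arch_pow[of 2 "2 * cmod w / r0"] by auto
      then have "\<forall>\<^sub>F n in sequentially. 2 * cmod w / r0 \<le> 2 ^ n"
        by (intro eventually_sequentiallyI[of m] order_trans[OF less_imp_le power_increasing]) auto
      then show ?thesis
      proof eventually_elim
        case (elim n)
        define s where "s = (2 * K) ^ n * r0 / 2"
        have s: "0 < s" using K r0 by (simp add: s_def)
        have "2 ^ n \<le> (2 * K) ^ n" using K by (intro power_mono) auto
        then have "2 * cmod w / r0 \<le> (2 * K) ^ n" using elim by linarith
        then have ws: "cmod w \<le> s" using r0 by (simp add: s_def pos_divide_le_eq)
        have "cmod ((deriv ^^ 1) f w) \<le> fact 1 * (D * K ^ n) / s ^ 1"
        proof (rule Cauchy_inequality[OF _ _ s])
          show "f holomorphic_on ball w s" using hol by (rule holomorphic_on_subset) simp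
          show "continuous_on (cball w s) f"
            by (rule holomorphic_on_imp_continuous_on[OF holomorphic_on_subset[OF hol]]) simp
          fix x assume "cmod (w - x) = s"
          then have "cmod x \<le> 2 * s"
            using norm_triangle_sub[of x w] ws by (simp add: norm_minus_commute)
          then show "cmod (f x) \<le> D * K ^ n" by (intro bd) (simp add: s_def)
        qed
        also have "fact 1 * (D * K ^ n) / s ^ 1 = 2 * D / r0 * (1 / 2) ^ n"
          using K r0 by (simp add: s_def power_mult_distrib power_divide mult_ac)
        finally show ?case by simp
      qed
    qed
    moreover have "(\<lambda>n. 2 * D / r0 * (1 / 2) ^ n) \<longlonglongrightarrow> 2 * D / r0 * 0"
      by (intro tendsto_intros LIMSEQ_realpow_zero) auto
    ultimately have "cmod (deriv f w) \<le> 2 * D / r0 * 0"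
      by (intro tendsto_lowerbound[OF _ _ sequentially_bot])
    then show ?thesis by simp
  qed
  then have "(f has_field_derivative 0) (at w)" for w
    using holomorphic_derivI[OF hol open_UNIV, of w UNIV] by simp
  then show ?thesis
    using has_field_derivative_zero_constant[of UNIV f] by (auto simp: constant_on_def)
qed

section \<open>Bounded composition operators\<close>

lemma bounded_composition_operator_iterates:
  assumes comp: "\<And>h. h \<in> de_Branges E \<Longrightarrow> h \<circ> \<phi> \<in> de_Branges E"
    and K: "0 \<le> K" "\<And>h. h \<in> de_Branges E \<Longrightarrow> dB_norm E (h \<circ> \<phi>) \<le> K * dB_norm E h"
    and f: "f \<in> de_Branges E"
  shows "f \<circ> (\<phi> ^^ n) \<in> de_Branges E \<and> dB_norm E (f \<circ> (\<phi> ^^ n)) \<le> K ^ n * dB_norm E f"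
proof (induction n)
  case 0
  then show ?case using f by (simp add: id_def o_def)
next
  case (Suc n)
  have eq: "f \<circ> (\<phi> ^^ Suc n) = (f \<circ> (\<phi> ^^ n)) \<circ> \<phi>"
    by (simp only: funpow_Suc_right o_assoc)
  have "dB_norm E ((f \<circ> (\<phi> ^^ n)) \<circ> \<phi>) \<le> K * dB_norm E (f \<circ> (\<phi> ^^ n))"
    using Suc K by blast
  also have "\<dots> \<le> K * (K ^ n * dB_norm E f)"
    by (rule mult_left_mono[OF conjunct2[OF Suc] K(1)])
  finally have "dB_norm E ((f \<circ> (\<phi> ^^ n)) \<circ> \<phi>) \<le> K ^ Suc n * dB_norm E f"
    by (simp only: power_Suc mult.assoc)
  then show ?case unfolding eq using Suc comp by blast
qed

theorem theorem5p3:
  fixes E \<phi> :: "complex \<Rightarrow> complex"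
  assumes "hermite_biehler E"
    and "dB_regular E"
    and "dB_nondegenerate E"
    and "\<phi> holomorphic_on UNIV"
    and "\<not> \<phi> constant_on UNIV"
    and "dB_bounded_operator E (composition_operator \<phi>)"
  shows "\<exists>a b. \<forall>z. \<phi> z = a * z + b"
proof (rule ccontr)
  assume naff: "\<not> ?thesis"
  obtain f where f: "f \<in> de_Branges E" and nonconst: "\<not> f constant_on UNIV"
    using assms(3) by (auto simp: dB_nondegenerate_def)
  have holf: "f holomorphic_on UNIV" using f by (simp add: de_Branges_def)
  obtain K0 where comp: "\<And>h. h \<in> de_Branges E \<Longrightarrow> h \<circ> \<phi> \<in> de_Branges E"
    and K0: "\<And>h. h \<in> de_Branges E \<Longrightarrow> dB_norm E (h \<circ> \<phi>) \<le> K0 * dB_norm E h"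
    using assms(6) unfolding dB_bounded_operator_def composition_operator_def by blast
  define K where "K = max K0 1"
  have K1: "1 \<le> K" and K0_le: "0 \<le> K" by (simp_all add: K_def)
  have K: "dB_norm E (h \<circ> \<phi>) \<le> K * dB_norm E h" if "h \<in> de_Branges E" for h
    using K0[OF that] mult_right_mono[of K0 K "dB_norm E h"] dB_norm_nonneg[of E h]
    by (simp add: K_def)
  \<comment> \<open>The expansion factor \<open>2 * K\<close> beats the factor \<open>K\<close> that each
    application of the operator may cost.\<close>
  obtain r0 where r0: "0 < r0" and step:
    "\<And>r g B w. r0 \<le> r \<Longrightarrow> g holomorphic_on UNIV \<Longrightarrow> (\<And>z. cmod z \<le> r \<Longrightarrow> cmod (g (\<phi> z)) \<le> B) \<Longrightarrow>
       cmod w \<le> (2 * K) * r \<Longrightarrow> cmod (g w) \<le> B"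
    using nonaffine_entire_pulls_back_bounds[OF assms(4) naff, of "2 * K"] K1 by auto
  obtain C where C: "0 \<le> C"
    "\<And>h z. h \<in> de_Branges E \<Longrightarrow> cmod z \<le> r0 \<Longrightarrow> cmod (h z) \<le> C * dB_norm E h"
    using de_Branges_evaluation_locally_bounded[OF assms(1)] by blast
  have "cmod (f w) \<le> (C * dB_norm E f) * K ^ n" if w: "cmod w \<le> (2 * K) ^ n * r0" for n w
  proof (rule iterates_pull_back_bounds[where \<phi> = \<phi> and g = f and n = n and ?r0.0 = r0 and \<Lambda> = "2 * K"])
    show "\<phi> holomorphic_on UNIV" "0 < r0" "f holomorphic_on UNIV" "cmod w \<le> (2 * K) ^ n * r0"
      by fact+
    show "1 \<le> 2 * K" using K1 by simp
    show "cmod (g v) \<le> B" if "r0 \<le> r" "g holomorphic_on UNIV"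
      "\<And>z. cmod z \<le> r \<Longrightarrow> cmod (g (\<phi> z)) \<le> B" "cmod v \<le> 2 * K * r" for r g B v
      by (rule step[of r g B v]) (use that in blast)+
    show "cmod (f ((\<phi> ^^ n) z)) \<le> (C * dB_norm E f) * K ^ n" if z: "cmod z \<le> r0" for z
    proof -
      have it: "f \<circ> (\<phi> ^^ n) \<in> de_Branges E"
        "dB_norm E (f \<circ> (\<phi> ^^ n)) \<le> K ^ n * dB_norm E f"
        using bounded_composition_operator_iterates[of E \<phi> K f n, OF comp K0_le K f] by blast+
      have "cmod (f ((\<phi> ^^ n) z)) \<le> C * dB_norm E (f \<circ> (\<phi> ^^ n))"
        using C(2)[OF it(1) z] by simp
      also have "\<dots> \<le> C * (K ^ n * dB_norm E f)"
        using it(2) C(1) by (rule mult_left_mono)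
      finally show ?thesis by (simp only: mult_ac)
    qed
  qed
  then have "f constant_on UNIV"
    by (rule entire_constant_if_slow_on_discs[OF holf r0 K1])
  then show False using nonconst by contradiction
qed

end
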